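(* Let $B$ be a nucleation process and $G$ a growth process on $[t_0,T]$, let $t\in[t_0,T]$ and let $\{\Pi_j\}_{j\in\mathbb N}$ and $\{\Pi'_l\}_{l\in\mathbb N}$ be two distinct refinement sequences of $[t_0,t]$. Then, almost surely, $$\lim_{j\to\infty,\ l\to\infty}\delta_H\big(s_{\Pi_j}(t),s_{\Pi'_l}(t)\big)=0\qquad\text{and}\qquad \lim_{j\to\infty,\ l\to\infty}\delta_H\big(S_{\Pi_j}(t),S_{\Pi'_l}(t)\big)=0$$ (limits as $j$ and $l$ jointly tend to infinity).
   Context: Setting. $\mathfrak X$ is a reflexive Banach space with separable dual; $[t_0,T]\subset\mathbb R$; $(\Omega,\mathfrak F,\{\mathfrak F_t\}_{t\in[t_0,T]},\mathbb P)$ is a filtered complete probability space satisfying the usual conditions. $\mathbb F(\mathfrak X)$ is the family of non-empty closed subsets of $\mathfrak X$. A set-valued map $X$ defined on a measurable space $(E,\mathcal E)$ with values in subsets of $\mathfrak X$ is measurable if $\{e: X(e)\cap O\neq\emptyset\}\in\mathcal E$ for every open $O\subseteq\mathfrak X$. The Hausdorff distance on $\mathbb F(\mathfrak X)$ (possibly $+\infty$) is $\delta_H(A,C)=\max\{\sup_{a\in A}\inf_{c\in C}\|a-c\|,\ \sup_{c\in C}\inf_{a\in A}\|a-c\|\}$. Nucleation process: a map $B:\Omega\times[t_0,T]\to\mathbb F(\mathfrak X)$, $B_t=B(\cdot,t)$, such that $B_t$ is $\mathfrak F_t$-measurable for every $t$, and $B_s\subseteq B_t$ whenever $s<t$. Growth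 process: a map $G:\Omega\times[t_0,T]\to\mathbb F(\mathfrak X)$ such that for all $(\omega,t)$: $0\in G(\omega,t)$, $G(\omega,t)$ is convex, $G(\omega,t)\subseteq K$ for a fixed non-empty closed bounded set $K\subset\mathfrak X$ (independent of $\omega,t$), and $G$ is measurable with respect to the predictable $\sigma$-algebra $\mathcal P$ on $\Omega\times[t_0,T]$, i.e. the $\sigma$-algebra generated by the sets $A\times\{t_0\}$ with $A\in\mathfrak F_{t_0}$ and $A\times(s,t]$ with $A\in\mathfrak F_s$, $(s,t]\subset[t_0,T]$. For $a\le b$, $\int_a^b G(\tau)\,d\tau$ is the random set $\omega\mapsto\int_a^bG(\omega,\tau)\,d\tau$, the Aumann integral with respect to Lebesgue measure: $\{\int_a^b g(\tau)\,d\tau: g \text{ Bochner integrable on }[t_0,T],\ g(\tau)\in G(\omega,\tau)\text{ for a.e. }\tau\}$. Minkowski sum: $A+C=\{a+c:a\in A,c\in C\}$ (with $\emptyset+A=\emptyset$), and $A\oplus C=\overline{A+C}$. A partition of $[t_0,t]$ is $\Pi=(t_i)_{i=0}^n$ with $t_0<t_1<\dots<t_n=t$; its mesh is $|\Pi|=\max_i(t_i-t_{i-1})$. A refinement sequence of $[t_0,t]$ is a sequence of partitions $\{\Pi_j\}_{j\in\mathbb N}$ of $[t_0,t]$ with $|\Pi_j|\to0$ as $j\to\infty$. Put $\Delta B_{t_i}=B_{t_i}\setminus B_{t_{i-1}}^{o}$, where $B^{o}$ is the interior of $B$, and $$s_\Pi(t)=\Big(B_{t_0}\oplus\int_{t_0}^tG(\tau)d\tau\Big)\cup\bigcup_{i=1}^n\Big(\Delta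 B_{t_i}\oplus\int_{t_i}^tG(\tau)d\tau\Big),$$ $$S_\Pi(t)=\Big(B_{t_0}\oplus\int_{t_0}^tG(\tau)d\tau\Big)\cup\bigcup_{i=1}^n\Big(\Delta B_{t_i}\oplus\int_{t_{i-1}}^tG(\tau)d\tau\Big).$$ *)

theory Defs
  imports "HOL-Probability.Probability" "HOL-Library.Set_Algebras"
begin

definition reflexive_space :: "'a::real_normed_vector itself \<Rightarrow> bool" where
  "reflexive_space _ \<longleftrightarrow>
     (\<forall>\<phi> :: ('a \<Rightarrow>\<^sub>L real) \<Rightarrow>\<^sub>L real. \<exists>x. \<forall>f. blinfun_apply \<phi> f = blinfun_apply f x)"

definition separable_dual :: "'a::real_normed_vector itself \<Rightarrow> bool" where
  "separable_dual _ \<longleftrightarrow> separable_space (euclidean :: ('a \<Rightarrow>\<^sub>L real) topology)"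

definition closed_sets :: "'a::topological_space set set" where
  "closed_sets = {A. closed A \<and> A \<noteq> {}}"

definition measurable_setvalued :: "'e measure \<Rightarrow> ('e \<Rightarrow> 'a::topological_space set) \<Rightarrow> bool" where
  "measurable_setvalued N X \<longleftrightarrow>
     (\<forall>U. open U \<longrightarrow> {e \<in> space N. X e \<inter> U \<noteq> {}} \<in> sets N)"

text \<open>The Hausdorff distance may be infinite; the norms are nonnegative, so it takes its
  values in \<^typ>\<open>ennreal\<close>.\<close>

definition hausdorff_distance ::
    "'a::real_normed_vector set \<Rightarrow> 'a set \<Rightarrow> ennreal" where
  "hausdorff_distance A C =
     max (SUP a\<in>A. INF c\<in>C. ennreal (norm (a - c))) (SUP c\<in>C. INF a\<in>A. ennreal (norm (a - c)))"

text \<open>Only the \<open>\<sigma>\<close>-algebras \<open>sets (F t)\<close> for \<open>t \<in> [t0, T]\<close> matter below.\<close>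

definition usual_filtered_prob_space ::
    "'w measure \<Rightarrow> (real \<Rightarrow> 'w measure) \<Rightarrow> real \<Rightarrow> real \<Rightarrow> bool" where
  "usual_filtered_prob_space M F t0 T \<longleftrightarrow>
     prob_space M \<and> complete_measure M \<and>
     (\<forall>t\<in>{t0..T}. subalgebra M (F t)) \<and>
     (\<forall>s\<in>{t0..T}. \<forall>t\<in>{t0..T}. s \<le> t \<longrightarrow> sets (F s) \<subseteq> sets (F t)) \<and>
     null_sets M \<subseteq> sets (F t0) \<and>
     (\<forall>t\<in>{t0..<T}. sets (F t) = (\<Inter>s\<in>{t<..T}. sets (F s)))"

definition predictable_algebra ::
    "'w measure \<Rightarrow> (real \<Rightarrow> 'w measure) \<Rightarrow> real \<Rightarrow> real \<Rightarrow> ('w \<times> real) measure" where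
  "predictable_algebra M F t0 T = sigma (space M \<times> {t0..T})
     ({A \<times> {t0} |A. A \<in> sets (F t0)} \<union>
      {A \<times> {s<..t} |A s t. t0 \<le> s \<and> s < t \<and> t \<le> T \<and> A \<in> sets (F s)})"

definition nucleation_process ::
    "'w measure \<Rightarrow> (real \<Rightarrow> 'w measure) \<Rightarrow> real \<Rightarrow> real \<Rightarrow>
     ('w \<Rightarrow> real \<Rightarrow> 'a::real_normed_vector set) \<Rightarrow> bool" where
  "nucleation_process M F t0 T B \<longleftrightarrow>
     (\<forall>\<omega>\<in>space M. \<forall>t\<in>{t0..T}. B \<omega> t \<in> closed_sets) \<and>
     (\<forall>t\<in>{t0..T}. measurable_setvalued (F t) (\<lambda>\<omega>. B \<omega> t)) \<and>
     (\<forall>\<omega>\<in>space M. \<forall>s\<in>{t0..T}. \<forall>t\<in>{t0..T}. s < t \<longrightarrow> B \<omega> s \<subseteq> B \<omega> t)"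

definition growth_process ::
    "'w measure \<Rightarrow> (real \<Rightarrow> 'w measure) \<Rightarrow> real \<Rightarrow> real \<Rightarrow>
     ('w \<Rightarrow> real \<Rightarrow> 'a::real_normed_vector set) \<Rightarrow> bool" where
  "growth_process M F t0 T G \<longleftrightarrow>
     (\<forall>\<omega>\<in>space M. \<forall>t\<in>{t0..T}. G \<omega> t \<in> closed_sets \<and> 0 \<in> G \<omega> t \<and> convex (G \<omega> t)) \<and>
     (\<exists>K. K \<noteq> {} \<and> closed K \<and> bounded K \<and> (\<forall>\<omega>\<in>space M. \<forall>t\<in>{t0..T}. G \<omega> t \<subseteq> K)) \<and>
     measurable_setvalued (predictable_algebra M F t0 T) (\<lambda>(\<omega>, t). G \<omega> t)"

text \<open>The selections are defined on the whole of \<open>[t0, T]\<close> and integrated over \<open>[a, b]\<close>.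
  The library's Bochner integral requires the class \<^class>\<open>second_countable_topology\<close>,
  i.e. separability of the space, which is implied by separability of its dual.\<close>

definition aumann_integral ::
    "real \<Rightarrow> real \<Rightarrow> (real \<Rightarrow> 'a::{banach, second_countable_topology} set) \<Rightarrow>
     real \<Rightarrow> real \<Rightarrow> 'a set" where
  "aumann_integral t0 T H a b =
     {(LINT \<tau>:{a..b}|lebesgue. g \<tau>) |g.
        set_integrable lebesgue {t0..T} g \<and> (AE \<tau> in lebesgue. \<tau> \<in> {t0..T} \<longrightarrow> g \<tau> \<in> H \<tau>)}"

definition closed_minkowski_sum ::
    "'a::real_normed_vector set \<Rightarrow> 'a set \<Rightarrow> 'a set" (infixl \<open>\<oplus>\<^sub>M\<close> 66) where
  "A \<oplus>\<^sub>M C = closure (A + C)"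

text \<open>A partition \<open>t0 = t\<^sub>0 < \<dots> < t\<^sub>n = t\<close> is the list of its \<open>n + 1\<close> points.
  In the degenerate case \<open>t = t0\<close> the only partition is \<open>[t0]\<close>, of mesh 0.\<close>

definition partition_of :: "real \<Rightarrow> real \<Rightarrow> real list \<Rightarrow> bool" where
  "partition_of t0 t P \<longleftrightarrow> P \<noteq> [] \<and> sorted_wrt (<) P \<and> hd P = t0 \<and> last P = t"

definition mesh :: "real list \<Rightarrow> real" where
  "mesh P = (if length P \<le> 1 then 0 else Max ((\<lambda>i. P ! i - P ! (i - 1)) ` {1..<length P}))"

definition refinement_sequence :: "real \<Rightarrow> real \<Rightarrow> (nat \<Rightarrow> real list) \<Rightarrow> bool" where
  "refinement_sequence t0 t P \<longleftrightarrow>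
     (\<forall>j. partition_of t0 t (P j)) \<and> (\<lambda>j. mesh (P j)) \<longlonglongrightarrow> 0"

text \<open>In the next three definitions \<open>B\<close> and \<open>G\<close> are the paths \<open>B(\<omega>, \<cdot>)\<close> and \<open>G(\<omega>, \<cdot>)\<close>
  for a fixed \<open>\<omega>\<close>.\<close>

definition increment :: "(real \<Rightarrow> 'a::real_normed_vector set) \<Rightarrow> real list \<Rightarrow> nat \<Rightarrow> 'a set" where
  "increment B P i = B (P ! i) - interior (B (P ! (i - 1)))"

definition lower_sum ::
    "real \<Rightarrow> real \<Rightarrow> (real \<Rightarrow> 'a::{banach, second_countable_topology} set) \<Rightarrow>
     (real \<Rightarrow> 'a set) \<Rightarrow> real list \<Rightarrow> real \<Rightarrow> 'a set" where
  "lower_sum t0 T B G P t =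
     (B t0 \<oplus>\<^sub>M aumann_integral t0 T G t0 t) \<union>
     (\<Union>i\<in>{1..<length P}. increment B P i \<oplus>\<^sub>M aumann_integral t0 T G (P ! i) t)"

definition upper_sum ::
    "real \<Rightarrow> real \<Rightarrow> (real \<Rightarrow> 'a::{banach, second_countable_topology} set) \<Rightarrow>
     (real \<Rightarrow> 'a set) \<Rightarrow> real list \<Rightarrow> real \<Rightarrow> 'a set" where
  "upper_sum t0 T B G P t =
     (B t0 \<oplus>\<^sub>M aumann_integral t0 T G t0 t) \<union>
     (\<Union>i\<in>{1..<length P}. increment B P i \<oplus>\<^sub>M aumann_integral t0 T G (P ! (i - 1)) t)"

end

theory Submission
  imports Defs
begin

text \<open>
  The estimate holds for every path. Since \<open>0 \<in> G\<close>, the integrals \<open>\<integral>\<^bsub>a\<^esub>\<^bsup>t\<^esup> G\<close> decrease in the lower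
  limit \<open>a\<close>; since \<open>G\<close> is bounded by \<open>m\<close>, integrating the same selection shows that they move by at
  most \<open>m \<bar>a - b\<bar>\<close>. Let \<open>x \<in> B\<^bsub>t\<^sub>i\<^esub>\<close> be a nucleation point of the partition \<open>P\<close>, and let \<open>k\<close> be the
  first index with \<open>x \<in> B\<^bsub>u\<^sub>k\<^esub>\<close> in the partition \<open>Q = (u\<^sub>k)\<close>. Then \<open>x\<close> is also a nucleation point of
  \<open>Q\<close> at \<open>k\<close>, and \<open>u\<^bsub>k-1\<^esub> < t\<^sub>i\<close> by monotonicity of \<open>B\<close>, so it is born in \<open>Q\<close> at most
  \<open>\<bar>P\<bar> + \<bar>Q\<bar>\<close> later than in \<open>P\<close>. Hence the distances are at most \<open>m (\<bar>P\<bar> + \<bar>Q\<bar>)\<close>.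
\<close>

section \<open>Bounding the Hausdorff distance by pointwise approximation\<close>

text \<open>The slack \<open>e\<close> leaves room for points of a closure, which are only
  approximated; letting it tend to 0 recovers the exact bound \<open>r\<close>.\<close>

lemma INF_norm_leI:
  assumes "\<And>e::real. e > 0 \<Longrightarrow> \<exists>c\<in>C. norm (a - c) \<le> r + e" and "0 \<le> r"
  shows "(INF c\<in>C. ennreal (norm (a - c))) \<le> ennreal r"
proof (rule ennreal_le_epsilon)
  fix e :: real
  assume "0 < e"
  then obtain c where c: "c \<in> C" "norm (a - c) \<le> r + e"
    using assms(1) by blast
  have "(INF c\<in>C. ennreal (norm (a - c))) \<le> ennreal (norm (a - c))"
    using c(1) by (rule INF_lower)
  also have "\<dots> \<le> ennreal (r + e)"
    using c(2) by (rule ennreal_leI)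
  also have "\<dots> = ennreal r + ennreal e"
    using \<open>0 < e\<close> \<open>0 \<le> r\<close> by simp
  finally show "(INF c\<in>C. ennreal (norm (a - c))) \<le> ennreal r + ennreal e" .
qed

lemma hausdorff_distance_leI:
  assumes "\<And>a e::real. a \<in> A \<Longrightarrow> e > 0 \<Longrightarrow> \<exists>c\<in>C. norm (a - c) \<le> r + e"
    and "\<And>c e::real. c \<in> C \<Longrightarrow> e > 0 \<Longrightarrow> \<exists>a\<in>A. norm (c - a) \<le> r + e"
    and "0 \<le> r"
  shows "hausdorff_distance A C \<le> ennreal r"
  unfolding hausdorff_distance_def
  using assms by (auto intro!: SUP_least INF_norm_leI simp: norm_minus_commute)

section \<open>Aumann integrals with varying lower limit\<close>

text \<open>A selection set to 0 before \<open>b\<close> is still a selection because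
  \<open>0 \<in> H \<tau>\<close>, and its integral from \<open>a\<close> equals the original one
  from \<open>b\<close>.\<close>

lemma aumann_integral_antimono:
  assumes "t0 \<le> a" "a \<le> b" "t \<le> T" and zero: "\<And>\<tau>. \<tau> \<in> {t0..T} \<Longrightarrow> 0 \<in> H \<tau>"
  shows "aumann_integral t0 T H b t \<subseteq> aumann_integral t0 T H a t"
proof
  fix y
  assume "y \<in> aumann_integral t0 T H b t"
  then obtain g where y: "y = (LINT \<tau>:{b..t}|lebesgue. g \<tau>)"
    and g: "set_integrable lebesgue {t0..T} g" "AE \<tau> in lebesgue. \<tau> \<in> {t0..T} \<longrightarrow> g \<tau> \<in> H \<tau>"
    unfolding aumann_integral_def by blast
  define h where "h \<tau> = indicat_real {b..T} \<tau> *\<^sub>R g \<tau>" for \<tau>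
  have "set_integrable lebesgue {b..T} g"
    using g(1) by (rule set_integrable_subset) (use assms in auto)
  moreover have "(\<lambda>\<tau>. indicat_real {t0..T} \<tau> *\<^sub>R h \<tau>) = (\<lambda>\<tau>. indicat_real {b..T} \<tau> *\<^sub>R g \<tau>)"
    using assms by (auto simp: h_def indicator_def fun_eq_iff)
  ultimately have "set_integrable lebesgue {t0..T} h"
    unfolding set_integrable_def by simp
  moreover have "AE \<tau> in lebesgue. \<tau> \<in> {t0..T} \<longrightarrow> h \<tau> \<in> H \<tau>"
    using g(2) by eventually_elim (auto simp: h_def indicator_def zero)
  moreover have "y = (LINT \<tau>:{a..t}|lebesgue. h \<tau>)"
    unfolding y set_lebesgue_integral_def
    by (rule Bochner_Integration.integral_cong) (use assms in \<open>auto simp: h_def indicator_def\<close>)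
  ultimately show "y \<in> aumann_integral t0 T H a t"
    unfolding aumann_integral_def by blast
qed

lemma norm_set_integral_le:
  fixes g :: "real \<Rightarrow> 'a::{banach, second_countable_topology}"
  assumes "a \<le> b" and "set_integrable lebesgue {a..<b} g"
    and "AE \<tau> in lebesgue. \<tau> \<in> {a..<b} \<longrightarrow> norm (g \<tau>) \<le> m"
  shows "norm (LINT \<tau>:{a..<b}|lebesgue. g \<tau>) \<le> m * (b - a)"
proof -
  have "norm (LINT \<tau>:{a..<b}|lebesgue. g \<tau>) \<le> (LINT \<tau>|lebesgue. m * indicat_real {a..<b} \<tau>)"
    unfolding set_lebesgue_integral_def
  proof (rule order_trans[OF integral_norm_bound integral_mono_AE])
    show "integrable lebesgue (\<lambda>\<tau>. norm (indicat_real {a..<b} \<tau> *\<^sub>R g \<tau>))"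
      using assms(2) by (intro integrable_norm) (simp add: set_integrable_def)
    show "integrable lebesgue (\<lambda>\<tau>. m * indicat_real {a..<b} \<tau>)"
      using assms(1) by (auto intro!: integrable_mult_right integrable_real_indicator)
    show "AE \<tau> in lebesgue. norm (indicat_real {a..<b} \<tau> *\<^sub>R g \<tau>) \<le> m * indicat_real {a..<b} \<tau>"
      using assms(3) by eventually_elim (auto simp: indicator_def)
  qed
  also have "\<dots> = m * (b - a)"
    using assms(1) by simp
  finally show ?thesis .
qed

text \<open>Only a lower limit \<open>b\<close> later than \<open>a\<close> costs anything, hence
  the one-sided condition on \<open>b\<close>. In that case the same selection is integrated from
  \<open>b\<close>, and what is lost is its integral over \<open>{a..<b}\<close>.\<close>

lemma aumann_integral_near:
  assumes "t0 \<le> a" "t0 \<le> b" "b \<le> t" "t \<le> T" "b \<le> a + \<delta>" "0 \<le> \<delta>" "0 \<le> m"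
    and H: "\<And>\<tau>. \<tau> \<in> {t0..T} \<Longrightarrow> 0 \<in> H \<tau> \<and> (\<forall>x\<in>H \<tau>. norm x \<le> m)"
    and y: "y \<in> aumann_integral t0 T H a t"
  shows "\<exists>z\<in>aumann_integral t0 T H b t. norm (y - z) \<le> m * \<delta>"
proof (cases "b \<le> a")
  case True
  then have "y \<in> aumann_integral t0 T H b t"
    using aumann_integral_antimono[of t0 b a t T H] assms by blast
  then show ?thesis
    using assms(6,7) by (intro bexI[of _ y]) auto
next
  case False
  from y obtain g where y: "y = (LINT \<tau>:{a..t}|lebesgue. g \<tau>)"
    and g: "set_integrable lebesgue {t0..T} g" "AE \<tau> in lebesgue. \<tau> \<in> {t0..T} \<longrightarrow> g \<tau> \<in> H \<tau>"
    unfolding aumann_integral_def by blast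
  have int: "set_integrable lebesgue {a..<b} g" "set_integrable lebesgue {b..t} g"
    by (rule set_integrable_subset[OF g(1)]; use assms in auto)+
  have "{a..t} = {a..<b} \<union> {b..t}" "{a..<b} \<inter> {b..t} = {}"
    using False assms by auto
  then have "y - (LINT \<tau>:{b..t}|lebesgue. g \<tau>) = (LINT \<tau>:{a..<b}|lebesgue. g \<tau>)"
    using set_integral_Un[OF _ int] by (simp add: y)
  moreover have "norm (LINT \<tau>:{a..<b}|lebesgue. g \<tau>) \<le> m * (b - a)"
  proof (rule norm_set_integral_le)
    show "AE \<tau> in lebesgue. \<tau> \<in> {a..<b} \<longrightarrow> norm (g \<tau>) \<le> m"
      using g(2)
    proof eventually_elim
      case (elim \<tau>)
      then show ?case
        using H[of \<tau>] assms(1-4) by auto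
    qed
  qed (use False int in auto)
  moreover have "m * (b - a) \<le> m * \<delta>"
    using assms by (intro mult_left_mono) auto
  moreover have "(LINT \<tau>:{b..t}|lebesgue. g \<tau>) \<in> aumann_integral t0 T H b t"
    using g unfolding aumann_integral_def by blast
  ultimately show ?thesis
    by (metis order_trans)
qed

text \<open>Genuine sums \<open>x + y\<close> are dense in the closed sum, so an estimate for them
  carries over at the cost of \<open>e\<close>.\<close>

lemma closed_minkowski_sum_near:
  assumes "z \<in> A \<oplus>\<^sub>M C" and "e > 0"
    and near: "\<And>x y. x \<in> A \<Longrightarrow> y \<in> C \<Longrightarrow> \<exists>w\<in>S. norm (x + y - w) \<le> r"
  shows "\<exists>w\<in>S. norm (z - w) \<le> r + e"
proof -
  obtain x y where xy: "x \<in> A" "y \<in> C" "dist (x + y) z < e"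
    using assms(1,2) unfolding closed_minkowski_sum_def closure_approachable
    by (metis set_plus_elim)
  then obtain w where "w \<in> S" "norm (x + y - w) \<le> r"
    using near by blast
  moreover from this xy(3) have "norm (z - w) \<le> r + e"
    using norm_triangle_ineq[of "z - (x + y)" "x + y - w"]
    by (simp add: dist_norm norm_minus_commute)
  ultimately show ?thesis
    by blast
qed

section \<open>Partitions and the first index that captures a point\<close>

lemma mesh_ge:
  assumes "1 \<le> i" "i < length P"
  shows "P ! i - P ! (i - 1) \<le> mesh P"
  using assms by (auto simp: mesh_def intro!: Max_ge)

lemma partition_of_nth_mono:
  assumes "partition_of t0 t P" "i \<le> j" "j < length P"
  shows "P ! i \<le> P ! j"
  using assms unfolding partition_of_def
  by (metis le_neq_implies_less less_eq_real_def sorted_wrt_nth_less)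

lemma partition_of_nth_0: "partition_of t0 t P \<Longrightarrow> P ! 0 = t0"
  unfolding partition_of_def by (metis hd_conv_nth)

lemma partition_of_nth_last: "partition_of t0 t P \<Longrightarrow> P ! (length P - 1) = t"
  unfolding partition_of_def by (metis last_conv_nth)

lemma partition_of_nth_mem:
  assumes "partition_of t0 t P" "i < length P"
  shows "P ! i \<in> {t0..t}"
  using partition_of_nth_mono[OF assms(1), of 0 i] assms
    partition_of_nth_mono[OF assms(1), of i "length P - 1"]
    partition_of_nth_0[OF assms(1)] partition_of_nth_last[OF assms(1)]
  by auto

lemma mesh_nonneg:
  assumes "partition_of t0 t P"
  shows "0 \<le> mesh P"
proof (cases "length P \<le> 1")
  case False
  then show ?thesis
    using mesh_ge[of 1 P] partition_of_nth_mono[OF assms, of 0 1] by simp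
qed (simp add: mesh_def)

lemma partition_of_first_hit:
  assumes Q: "partition_of t0 t Q" and "x \<in> B t"
  obtains "x \<in> B t0"
  | k where "1 \<le> k" "k < length Q" "x \<in> B (Q ! k)" "x \<notin> B (Q ! (k - 1))"
proof -
  \<comment> \<open>The minimum runs over all naturals; the last index of \<open>Q\<close>, whose
    point is \<open>t\<close>, is a witness and keeps \<open>k\<close> inside the list.\<close>
  define k where "k = (LEAST k. x \<in> B (Q ! k))"
  have last: "x \<in> B (Q ! (length Q - 1))"
    using assms(2) partition_of_nth_last[OF Q] by simp
  then have k: "x \<in> B (Q ! k)" "k \<le> length Q - 1"
    unfolding k_def by (rule LeastI, intro Least_le)
  have "Q \<noteq> []"
    using Q by (simp add: partition_of_def)
  show thesis
  proof (cases "k = 0")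
    case True
    then show thesis
      using k(1) that(1) Q by (simp add: partition_of_nth_0)
  next
    case False
    then have "x \<notin> B (Q ! (k - 1))"
      using not_less_Least[of "k - 1" "\<lambda>k. x \<in> B (Q ! k)"] by (simp add: k_def)
    moreover have "k < length Q"
      using k(2) \<open>Q \<noteq> []\<close> by (metis Suc_pred' length_greater_0_conv less_Suc_eq_le)
    ultimately show thesis
      using False k(1) that(2)[of k] by auto
  qed
qed

section \<open>Comparing the sums of two partitions\<close>

text \<open>The cases \<open>d = 0\<close> and \<open>d = 1\<close> are the lower and the upper sum.\<close>

definition shifted_sum ::
    "nat \<Rightarrow> real \<Rightarrow> real \<Rightarrow> (real \<Rightarrow> 'a::{banach, second_countable_topology} set) \<Rightarrow>
     (real \<Rightarrow> 'a set) \<Rightarrow> real list \<Rightarrow> real \<Rightarrow> 'a set" where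
  "shifted_sum d t0 T B G P t =
     (B t0 \<oplus>\<^sub>M aumann_integral t0 T G t0 t) \<union>
     (\<Union>i\<in>{1..<length P}. increment B P i \<oplus>\<^sub>M aumann_integral t0 T G (P ! (i - d)) t)"

lemma lower_sum_eq_shifted_sum: "lower_sum t0 T B G P t = shifted_sum 0 t0 T B G P t"
  by (simp add: lower_sum_def shifted_sum_def)

lemma upper_sum_eq_shifted_sum: "upper_sum t0 T B G P t = shifted_sum 1 t0 T B G P t"
  by (simp add: upper_sum_def shifted_sum_def)

lemma plus_mem_closed_minkowski_sum: "x \<in> A \<Longrightarrow> y \<in> C \<Longrightarrow> x + y \<in> A \<oplus>\<^sub>M C"
  unfolding closed_minkowski_sum_def by (rule subsetD[OF closure_subset set_plus_intro])

text \<open>The nucleation point \<open>x\<close> is kept and only the growth part \<open>y\<close>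
  is replaced. Exchanging \<open>P\<close> and \<open>Q\<close> gives the other half of the
  Hausdorff distance.\<close>

lemma shifted_sum_near:
  assumes P: "partition_of t0 t P" and Q: "partition_of t0 t Q"
    and "t \<le> T" "d \<le> 1" "0 \<le> m"
    and B: "\<And>r s. t0 \<le> r \<Longrightarrow> r \<le> s \<Longrightarrow> s \<le> t \<Longrightarrow> B r \<subseteq> B s"
    and G: "\<And>\<tau>. \<tau> \<in> {t0..T} \<Longrightarrow> 0 \<in> G \<tau> \<and> (\<forall>x\<in>G \<tau>. norm x \<le> m)"
    and z: "z \<in> shifted_sum d t0 T B G P t" and "e > 0"
  shows "\<exists>w\<in>shifted_sum d t0 T B G Q t. norm (z - w) \<le> m * (mesh P + mesh Q) + e"
proof -
  let ?S = "shifted_sum d t0 T B G Q t" and ?\<delta> = "mesh P + mesh Q"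
  have \<delta>: "0 \<le> ?\<delta>"
    using mesh_nonneg P Q by fastforce
  consider "z \<in> B t0 \<oplus>\<^sub>M aumann_integral t0 T G t0 t"
    | i where "i \<in> {1..<length P}"
        "z \<in> increment B P i \<oplus>\<^sub>M aumann_integral t0 T G (P ! (i - d)) t"
    using z unfolding shifted_sum_def by blast
  then show ?thesis
  proof cases
    case 1
    then have "z \<in> ?S"
      by (simp add: shifted_sum_def)
    then show ?thesis
      using \<open>0 \<le> m\<close> \<delta> \<open>e > 0\<close> by (intro bexI[of _ z]) auto
  next
    case (2 i)
    then have i: "1 \<le> i" "i < length P"
      by auto
    have Pi: "P ! i \<in> {t0..t}" "P ! (i - d) \<in> {t0..t}"
      using i by (auto intro!: partition_of_nth_mem[OF P] simp del: atLeastAtMost_iff)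
    show ?thesis
    proof (rule closed_minkowski_sum_near[OF 2(2) \<open>e > 0\<close>])
      fix x y
      assume x: "x \<in> increment B P i" and y: "y \<in> aumann_integral t0 T G (P ! (i - d)) t"
      have xi: "x \<in> B (P ! i)"
        using x by (simp add: increment_def)
      then have "x \<in> B t"
        using B Pi(1) by auto
      with Q show "\<exists>w\<in>?S. norm (x + y - w) \<le> m * ?\<delta>"
      proof (cases rule: partition_of_first_hit)
        case 1
        \<comment> \<open>Starting from \<open>t0\<close> only enlarges the integral, so here
          \<open>x + y\<close> itself lies in the sum for \<open>Q\<close>.\<close>
        have "y \<in> aumann_integral t0 T G t0 t"
          using y aumann_integral_antimono[of t0 t0 "P ! (i - d)" t T G] Pi(2) G \<open>t \<le> T\<close> by auto
        then have "x + y \<in> ?S"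
          using 1 by (simp add: shifted_sum_def plus_mem_closed_minkowski_sum)
        then show ?thesis
          using \<open>0 \<le> m\<close> \<delta> by (intro bexI[of _ "x + y"]) auto
      next
        case (2 k)
        have Qk: "Q ! (k - 1) \<in> {t0..t}" "Q ! (k - d) \<in> {t0..t}"
          using 2 by (auto intro!: partition_of_nth_mem[OF Q] simp del: atLeastAtMost_iff)
        \<comment> \<open>Otherwise monotonicity of \<open>B\<close> would put \<open>x\<close> into
          \<open>B (Q ! (k - 1))\<close>.\<close>
        have "Q ! (k - 1) < P ! i"
          using B[of "P ! i" "Q ! (k - 1)"] xi 2(4) Pi Qk by force
        moreover have "d = 0 \<or> d = 1"
          using \<open>d \<le> 1\<close> by linarith
        \<comment> \<open>For \<open>d = 0\<close> the step from \<open>Q ! (k - 1)\<close> to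
          \<open>Q ! k\<close> costs at most \<open>mesh Q\<close>; for \<open>d = 1\<close> the
          step from \<open>P ! (i - 1)\<close> to \<open>P ! i\<close> costs at most
          \<open>mesh P\<close>.\<close>
        ultimately have "Q ! (k - d) \<le> P ! (i - d) + ?\<delta>"
          using mesh_ge[OF i] mesh_ge[OF 2(1,2)] mesh_nonneg[OF P] mesh_nonneg[OF Q] by auto
        then obtain y' where y': "y' \<in> aumann_integral t0 T G (Q ! (k - d)) t"
          "norm (y - y') \<le> m * ?\<delta>"
          using aumann_integral_near[OF _ _ _ \<open>t \<le> T\<close> _ \<delta> \<open>0 \<le> m\<close> G y] Pi Qk by auto
        \<comment> \<open>Removing the interior removes only points of
          \<open>B (Q ! (k - 1))\<close>, and \<open>x\<close> is not one of them.\<close>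
        have "x \<in> increment B Q k"
          using 2(3,4) interior_subset by (auto simp: increment_def)
        then have "x + y' \<in> ?S"
          using y'(1) 2(1,2) plus_mem_closed_minkowski_sum by (fastforce simp: shifted_sum_def)
        then show ?thesis
          using y'(2) by (intro bexI[of _ "x + y'"]) auto
      qed
    qed
  qed
qed

text \<open>The bound is a multiple of a term in \<open>j\<close> plus a term in \<open>l\<close>,
  each tending to 0, so it vanishes along the product filter, which expresses the joint
  limit.\<close>

lemma shifted_sum_tendsto:
  assumes P: "refinement_sequence t0 t P" and Q: "refinement_sequence t0 t Q"
    and "t \<le> T" "d \<le> 1" "0 \<le> m"
    and B: "\<And>r s. t0 \<le> r \<Longrightarrow> r \<le> s \<Longrightarrow> s \<le> t \<Longrightarrow> B r \<subseteq> B s"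
    and G: "\<And>\<tau>. \<tau> \<in> {t0..T} \<Longrightarrow> 0 \<in> G \<tau> \<and> (\<forall>x\<in>G \<tau>. norm x \<le> m)"
  shows "((\<lambda>(j, l). hausdorff_distance
            (shifted_sum d t0 T B G (P j) t) (shifted_sum d t0 T B G (Q l) t)) \<longlongrightarrow> 0)
          (sequentially \<times>\<^sub>F sequentially)"
proof (rule tendsto_sandwich[OF _ _ tendsto_const])
  let ?r = "\<lambda>(j, l). ennreal (m * (mesh (P j) + mesh (Q l)))"
  have P': "partition_of t0 t (P j)" and Q': "partition_of t0 t (Q j)" for j
    using P Q by (auto simp: refinement_sequence_def)
  have "hausdorff_distance (shifted_sum d t0 T B G (P j) t) (shifted_sum d t0 T B G (Q l) t)
      \<le> ennreal (m * (mesh (P j) + mesh (Q l)))" for j l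
  proof (rule hausdorff_distance_leI)
    let ?L = "shifted_sum d t0 T B G (P j) t" and ?R = "shifted_sum d t0 T B G (Q l) t"
    show "\<exists>c\<in>?R. norm (a - c) \<le> m * (mesh (P j) + mesh (Q l)) + e" if "a \<in> ?L" "e > 0" for a e
      using shifted_sum_near[OF P' Q' assms(3-7) that] .
    show "\<exists>a\<in>?L. norm (c - a) \<le> m * (mesh (P j) + mesh (Q l)) + e" if "c \<in> ?R" "e > 0" for c e
      using shifted_sum_near[OF Q' P' assms(3-7) that] by (simp add: add.commute)
    show "0 \<le> m * (mesh (P j) + mesh (Q l))"
      using \<open>0 \<le> m\<close> mesh_nonneg[OF P'] mesh_nonneg[OF Q'] by simp
  qed
  then show "\<forall>\<^sub>F p in sequentially \<times>\<^sub>F sequentially. (case p of (j, l) \<Rightarrow>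
      hausdorff_distance (shifted_sum d t0 T B G (P j) t) (shifted_sum d t0 T B G (Q l) t)) \<le> ?r p"
    by (intro always_eventually) auto
  have "((\<lambda>p. mesh (P (fst p))) \<longlongrightarrow> 0) (sequentially \<times>\<^sub>F sequentially)"
    "((\<lambda>p. mesh (Q (snd p))) \<longlongrightarrow> 0) (sequentially \<times>\<^sub>F sequentially)"
    using P Q unfolding refinement_sequence_def
    by (auto intro: filterlim_compose[OF _ filterlim_fst] filterlim_compose[OF _ filterlim_snd])
  then have "((\<lambda>p. ennreal (m * (mesh (P (fst p)) + mesh (Q (snd p))))) \<longlongrightarrow> ennreal (m * (0 + 0)))
      (sequentially \<times>\<^sub>F sequentially)"
    by (intro tendsto_intros)
  then show "(?r \<longlongrightarrow> 0) (sequentially \<times>\<^sub>F sequentially)"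
    by (simp add: case_prod_unfold)
qed auto

theorem proposition4p6:
  fixes M :: "'w measure" and F :: "real \<Rightarrow> 'w measure"
    and t0 T t :: real
    and B G :: "'w \<Rightarrow> real \<Rightarrow> 'a::{banach, second_countable_topology} set"
    and P Q :: "nat \<Rightarrow> real list"
  assumes "reflexive_space TYPE('a)"
    and "separable_dual TYPE('a)"
    and "usual_filtered_prob_space M F t0 T"
    and "nucleation_process M F t0 T B"
    and "growth_process M F t0 T G"
    and "t \<in> {t0..T}"
    and "refinement_sequence t0 t P"
    and "refinement_sequence t0 t Q"
    and "P \<noteq> Q"
  shows "AE \<omega> in M.
      ((\<lambda>(j, l). hausdorff_distance
          (lower_sum t0 T (B \<omega>) (G \<omega>) (P j) t)
          (lower_sum t0 T (B \<omega>) (G \<omega>) (Q l) t)) \<longlongrightarrow> 0)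
        (sequentially \<times>\<^sub>F sequentially) \<and>
      ((\<lambda>(j, l). hausdorff_distance
          (upper_sum t0 T (B \<omega>) (G \<omega>) (P j) t)
          (upper_sum t0 T (B \<omega>) (G \<omega>) (Q l) t)) \<longlongrightarrow> 0)
        (sequentially \<times>\<^sub>F sequentially)"
proof (rule AE_I2)
  fix \<omega>
  assume \<omega>: "\<omega> \<in> space M"
  obtain K where K: "bounded K" "\<And>\<tau>. \<tau> \<in> {t0..T} \<Longrightarrow> G \<omega> \<tau> \<subseteq> K"
    using assms(5) \<omega> unfolding growth_process_def by blast
  then obtain m where m: "0 < m" "\<And>x. x \<in> K \<Longrightarrow> norm x \<le> m"
    by (auto simp: bounded_pos)
  have G: "0 \<in> G \<omega> \<tau> \<and> (\<forall>x\<in>G \<omega> \<tau>. norm x \<le> m)" if "\<tau> \<in> {t0..T}" for \<tau>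
    using assms(5) \<omega> K(2) m(2) that unfolding growth_process_def by blast
  \<comment> \<open>A nucleation process is monotone for strictly ordered times by definition; equal
    times are added here.\<close>
  have B: "B \<omega> r \<subseteq> B \<omega> s" if "t0 \<le> r" "r \<le> s" "s \<le> t" for r s
  proof (cases "r = s")
    case False
    then have "r < s" "r \<in> {t0..T}" "s \<in> {t0..T}"
      using that assms(6) by auto
    then show ?thesis
      using assms(4) \<omega> unfolding nucleation_process_def by blast
  qed simp
  have "t \<le> T"
    using assms(6) by simp
  then show "((\<lambda>(j, l). hausdorff_distance
          (lower_sum t0 T (B \<omega>) (G \<omega>) (P j) t)
          (lower_sum t0 T (B \<omega>) (G \<omega>) (Q l) t)) \<longlongrightarrow> 0)
        (sequentially \<times>\<^sub>F sequentially) \<and>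
      ((\<lambda>(j, l). hausdorff_distance
          (upper_sum t0 T (B \<omega>) (G \<omega>) (P j) t)
          (upper_sum t0 T (B \<omega>) (G \<omega>) (Q l) t)) \<longlongrightarrow> 0)
        (sequentially \<times>\<^sub>F sequentially)"
    unfolding lower_sum_eq_shifted_sum upper_sum_eq_shifted_sum
    using shifted_sum_tendsto[OF assms(7,8) _ _ less_imp_le[OF m(1)] B G] by simp
qed

end
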